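(* Let $S\subset\mathbb{R}^n$ be closed and convex, let $\phi:\mathbb{R}^n\times\mathbb{R}^n\to\mathbb{R}$ satisfy $\phi(x,x)=0$ for all $x\in S$, and let $\bar S=\{x\in S\mid \phi(x,y)\ge 0\ \forall y\in S\}$ be nonempty and closed. Suppose $\partial_y\phi(x,x)\neq\emptyset$ for every $x\in S$ and that the set-valued map $x\mapsto\partial_y\phi(x,x)$ is monotone over $S$. If $\bar S$ is weakly sharp, then $\bar S$ is augmented weakly sharp with respect to every sequence $\{x^k\}\subset S$.
   Context: For $x\in S$, $\partial_y\phi(x,x)$ is the (general/limiting) subdifferential at the point $x$ of the function $\phi(x,\cdot)$. Here $v\in\partial g(x)$ iff there are $x^j\to x$ with $g(x^j)\to g(x)$ and $v^j\to v$ with $g(y)\ge g(x^j)+\langle v^j,y-x^j\rangle+o(\|y-x^j\|)$ for each $j$ (regular subgradients). Monotone over $S$ means $\langle u-w,x-z\rangle\ge0$ for all $x,z\in S$, $u\in\partial_y\phi(x,x)$, $w\in\partial_y\phi(z,z)$. For $C\subset\mathbb{R}^n$ and $x\in C$: the tangent cone $T_C(x)$ is the set of $d$ for which there are $x^j\in C$, $x^j\to x$, $\tau^j\downarrow0$ with $(x^j-x)/\tau^j\to d$; the regular normal cone is $\hat N_C(x)=\{d\mid\langle d,y-x\rangle\le o(\|y-x\|),\ y\in C\}$. For a set $D$, $D^\circ=\{y\mid\langle y,d\rangle\le0\ \forall d\in D\}$. $B$ is the closed unit ball. $P_C(x)$ is the projection, i.e. a point of $\arg\min_{y\in C}\|y-x\|$;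 if the nearest point is not unique, $P_C(x)$ denotes one nearest point, chosen once and for all. Weak sharpness: $\bar S$ is weakly sharp if there is a constant $\alpha>0$ with $\alpha B\subset\partial_y\phi(x,x)+[T_S(x)\cap\hat N_{\bar S}(x)]^\circ$ for all $x\in\bar S$. Augmented weak sharpness: $\bar S$ is augmented weakly sharp with respect to $\{x^k\}\subset S$ if, whenever $K=\{k\mid x^k\notin\bar S\}$ is infinite, there exists a set-valued mapping $H:\bar S\to2^{\mathbb{R}^n}$ such that (a) there is a constant $\alpha>0$ with $\alpha B\subset H(z)+[T_S(z)\cap\hat N_{\bar S}(z)]^\circ$ for all $z\in\bar S$; (b) for all choices $u^k\in\partial_y\phi(x^k,x^k)$ and $v^k\in H(P_{\bar S}(x^k))$ ($k\in K$), $$\limsup_{k\in K,\,k\to\infty}\frac{1}{\|x^k-P_{\bar S}(x^k)\|}\langle u^k-v^k,\,x^k-P_{\bar S}(x^k)\rangle\ge0.$$ (If $K$ is finite the condition holds vacuously.) *)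

theory Defs
  imports "HOL-Analysis.Analysis" "HOL-Library.Set_Algebras"
begin

text \<open>
  The set sum \<open>A + B\<close> below is the Minkowski sum of \<open>HOL-Library.Set_Algebras\<close>.
  The little-o conditions are written with an explicit \<open>e > 0\<close>; the filters \<open>at x\<close> exclude
  \<open>y = x\<close>, where both inequalities hold trivially.
\<close>

definition regular_subgradient :: "('a::real_inner \<Rightarrow> real) \<Rightarrow> 'a \<Rightarrow> 'a \<Rightarrow> bool" where
  "regular_subgradient g x v \<longleftrightarrow>
     (\<forall>e>0. \<forall>\<^sub>F y in at x. g y \<ge> g x + inner v (y - x) - e * norm (y - x))"

definition limiting_subdifferential :: "('a::real_inner \<Rightarrow> real) \<Rightarrow> 'a \<Rightarrow> 'a set" where
  "limiting_subdifferential g x =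
     {v. \<exists>xs vs. xs \<longlonglongrightarrow> x \<and> (\<lambda>j. g (xs j)) \<longlonglongrightarrow> g x \<and> vs \<longlonglongrightarrow> v \<and>
                 (\<forall>j. regular_subgradient g (xs j) (vs j))}"

definition diagonal_subdifferential :: "('a::real_inner \<Rightarrow> 'a \<Rightarrow> real) \<Rightarrow> 'a \<Rightarrow> 'a set" where
  "diagonal_subdifferential \<phi> x = limiting_subdifferential (\<phi> x) x"

definition monotone_map_on :: "'a::real_inner set \<Rightarrow> ('a \<Rightarrow> 'a set) \<Rightarrow> bool" where
  "monotone_map_on S T \<longleftrightarrow>
     (\<forall>x\<in>S. \<forall>z\<in>S. \<forall>u\<in>T x. \<forall>w\<in>T z. inner (u - w) (x - z) \<ge> 0)"

text \<open>\<open>\<tau> \<down> 0\<close> is read as convergence to \<open>0\<close> through positive values; requiring \<open>\<tau>\<close> to be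
  monotone as well gives the same cone, by passing to a subsequence.\<close>

definition tangent_cone :: "'a::real_inner set \<Rightarrow> 'a \<Rightarrow> 'a set" where
  "tangent_cone C x =
     {d. \<exists>xs \<tau>. (\<forall>j. xs j \<in> C) \<and> xs \<longlonglongrightarrow> x \<and> (\<forall>j. \<tau> j > 0) \<and> \<tau> \<longlonglongrightarrow> 0 \<and>
                 (\<lambda>j. (xs j - x) /\<^sub>R \<tau> j) \<longlonglongrightarrow> d}"

definition regular_normal_cone :: "'a::real_inner set \<Rightarrow> 'a \<Rightarrow> 'a set" where
  "regular_normal_cone C x =
     {d. \<forall>e>0. \<forall>\<^sub>F y in at x within C. inner d (y - x) \<le> e * norm (y - x)}"

definition polar :: "'a::real_inner set \<Rightarrow> 'a set" where
  "polar D = {y. \<forall>d\<in>D. inner y d \<le> 0}"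

definition equilibrium_set :: "('a \<Rightarrow> 'a \<Rightarrow> real) \<Rightarrow> 'a set \<Rightarrow> 'a set" where
  "equilibrium_set \<phi> S = {x\<in>S. \<forall>y\<in>S. \<phi> x y \<ge> 0}"

text \<open>Nearest points in a nonconvex set need not be unique, so the projection is an arbitrary
  fixed selection \<open>P\<close> of nearest points.\<close>

definition projection_onto :: "'a::real_inner set \<Rightarrow> ('a \<Rightarrow> 'a) \<Rightarrow> bool" where
  "projection_onto C P \<longleftrightarrow> (\<forall>x. P x \<in> C \<and> (\<forall>y\<in>C. norm (P x - x) \<le> norm (y - x)))"

definition weakly_sharp :: "('a::real_inner \<Rightarrow> 'a \<Rightarrow> real) \<Rightarrow> 'a set \<Rightarrow> bool" where
  "weakly_sharp \<phi> S \<longleftrightarrow>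
     (\<exists>\<alpha>>0. \<forall>x\<in>equilibrium_set \<phi> S.
        cball 0 \<alpha> \<subseteq> diagonal_subdifferential \<phi> x +
          polar (tangent_cone S x \<inter> regular_normal_cone (equilibrium_set \<phi> S) x))"

text \<open>Only the values of \<open>H\<close> on the equilibrium set matter. The limit superior over
  \<open>k \<in> K\<close>, \<open>k \<rightarrow> \<infinity>\<close> is taken in the extended reals, since the quotients may be unbounded.\<close>

definition augmented_weakly_sharp ::
  "('a::real_inner \<Rightarrow> 'a \<Rightarrow> real) \<Rightarrow> 'a set \<Rightarrow> ('a \<Rightarrow> 'a) \<Rightarrow> (nat \<Rightarrow> 'a) \<Rightarrow> bool" where
  "augmented_weakly_sharp \<phi> S P xs \<longleftrightarrow>
     (let Sbar = equilibrium_set \<phi> S; K = {k. xs k \<notin> Sbar} in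
      infinite K \<longrightarrow>
      (\<exists>H :: 'a \<Rightarrow> 'a set.
         (\<exists>\<alpha>>0. \<forall>z\<in>Sbar.
            cball 0 \<alpha> \<subseteq> H z + polar (tangent_cone S z \<inter> regular_normal_cone Sbar z)) \<and>
         (\<forall>u v. (\<forall>k\<in>K. u k \<in> diagonal_subdifferential \<phi> (xs k) \<and> v k \<in> H (P (xs k))) \<longrightarrow>
            Limsup (inf sequentially (principal K))
              (\<lambda>k. ereal (inner (u k - v k) (xs k - P (xs k)) / norm (xs k - P (xs k)))) \<ge> 0)))"

end

theory Submission
  imports Defs
begin

text \<open>Nearest points of the equilibrium set lie in \<open>S\<close>, so monotonicity compares
  \<open>xs k\<close> with \<open>P (xs k)\<close> for any chosen subgradients. A limit superior of
  nonnegative quotients over infinitely many indices is nonnegative.\<close>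

text \<open>The map \<open>H\<close> is the diagonal subdifferential itself: (a) is then weak sharpness, and
  monotonicity makes every quotient in (b) nonnegative.\<close>

theorem proposition3p1:
  fixes S :: "(real ^ 'n) set"
    and \<phi> :: "real ^ 'n \<Rightarrow> real ^ 'n \<Rightarrow> real"
    and P :: "real ^ 'n \<Rightarrow> real ^ 'n"
  assumes "closed S" and "convex S"
    and "\<forall>x\<in>S. \<phi> x x = 0"
    and "equilibrium_set \<phi> S \<noteq> {}" and "closed (equilibrium_set \<phi> S)"
    and "projection_onto (equilibrium_set \<phi> S) P"
    and "\<forall>x\<in>S. diagonal_subdifferential \<phi> x \<noteq> {}"
    and "monotone_map_on S (diagonal_subdifferential \<phi>)"
    and "weakly_sharp \<phi> S"
  shows "\<forall>xs :: nat \<Rightarrow> real ^ 'n. (\<forall>k. xs k \<in> S) \<longrightarrow> augmented_weakly_sharp \<phi> S P xs"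
proof (intro allI impI)
  fix xs :: "nat \<Rightarrow> real ^ 'n"
  assume xs: "\<forall>k. xs k \<in> S"
  define K where "K = {k. xs k \<notin> equilibrium_set \<phi> S}"
  let ?T = "diagonal_subdifferential \<phi>"
  let ?F = "inf sequentially (principal K)"
  have "0 \<le> Limsup ?F
      (\<lambda>k. ereal (inner (u k - v k) (xs k - P (xs k)) / norm (xs k - P (xs k))))"
    if "infinite K" and uv: "\<forall>k\<in>K. u k \<in> ?T (xs k) \<and> v k \<in> ?T (P (xs k))"
    for u v
  proof (rule le_Limsup)
    \<comment> \<open>Infinitude of \<open>K\<close> makes \<open>?F\<close> a proper filter; along
      the trivial filter the limit superior would be -\<infinity>.\<close>
    have "\<exists>\<^sub>F k in sequentially. k \<in> K"
      using \<open>infinite K\<close> by (simp add: frequently_cofinite flip: cofinite_eq_sequentially)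
    then show "?F \<noteq> bot"
      by (simp add: trivial_limit_def eventually_inf_principal frequently_def)
    have "P (xs k) \<in> S" for k
      using assms(6) by (simp add: projection_onto_def equilibrium_set_def)
    then have "0 \<le> inner (u k - v k) (xs k - P (xs k))" if "k \<in> K" for k
      using assms(8) xs uv that unfolding monotone_map_on_def by blast
    \<comment> \<open>The bound holds at every index in \<open>K\<close>, not just for large ones:
      dividing by a norm preserves nonnegativity.\<close>
    then show "\<forall>\<^sub>F k in ?F.
        0 \<le> ereal (inner (u k - v k) (xs k - P (xs k)) / norm (xs k - P (xs k)))"
      by (simp add: eventually_inf_principal)
  qed
  \<comment> \<open>With \<open>?T\<close> as witness, the same \<alpha> from weak sharpness serves
    in (a).\<close>
  then show "augmented_weakly_sharp \<phi> S P xs"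
    using assms(9) unfolding augmented_weakly_sharp_def weakly_sharp_def Let_def K_def[symmetric]
    by (intro impI exI[of _ ?T]) simp
qed

end
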